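(* Let $X=(W,Q,\pi,I)$ be a root independent irreducible quadruple (an object of $\mathscr D$). The category $\operatorname{span}(\operatorname{Sk}(X)/X)$ is isomorphic to the category $\mathcal L_X$.
   Context: Quadruples. For a Coxeter group $W$ of finite rank with simple reflections $s_1,\dots,s_n$, let $V$ be the real vector space with basis the simple roots $\alpha_1,\dots,\alpha_n$, with the form $\langle\alpha_i,\alpha_j\rangle=-\cos(\pi/\operatorname{ord}(s_is_j))$ and the usual geometric action of $W$. Write $[m]=\{1,\dots,m\}$. For a word $Q=s_{i_1}\cdots s_{i_m}$ and $\pi\in W$, the subword complex $\mathcal{SC}_W(Q,\pi)$ has as faces the subsets $I\subseteq[m]$ such that the subword of $Q$ at positions $[m]\setminus I$ contains a reduced expression of $\pi$. A quadruple is $X=(W,Q,\pi,I)$ with $I$ a maximal face of $\mathcal{SC}_W(Q,\pi)$. The root function is $r(l)=\big(\prod_{j\in[l-1]\setminus I}s_{i_j}\big)(\alpha_{i_l})$, $l\in[m]$ (product in increasing order of $j$). $X$ is irreducible if $\{r(i)\}_{i\in I}$ spans $V$; it is moreover root independent if $\{r(i)\}_{i\in I}$ is a basis of $V$. Subobjects. The flat of a subspace $U\subseteq V$ is $\mathrm F(U)=\{i\in[m]:r(i)\in U\}$. For $J\subseteq I$ put $f(J)=\mathrm F(\operatorname{span}\{r(i):i\in J\})$; it is an irreducible flat of $X$ with $f(J)\cap I=J$. Each flat $F$ determines a quadruple $X_F$ (supported on the root system $\Phi\cap\operatorname{span}\{r(i):i\in F\}$, where $\Phi$ is the root system of $W$,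 with word of length $|F|$ whose positions are labelled by $F$, face $F\cap I$, and the same root function values $r(i)$, $i\in F$). Write $X(J)=X_{f(J)}$; the $X(J)$, $J\subseteq I$, represent the subobjects of $X$ in the subword complex category, with canonical embeddings $i_J:X(J)\hookrightarrow X$. $\operatorname{Sk}(X)$ has objects $X(J)$, $J\subseteq I$, and morphisms the canonical embeddings. $\operatorname{span}(\operatorname{Sk}(X)/X)$: objects are the diagrams $a_J:X(J)\overset{i_J}{\hookrightarrow}X$ for $J\subseteq I$; $\operatorname{Mor}(a_J,a_H)$ is the set of diagrams $a_K:X(K)\overset{i_K}{\hookrightarrow}X$ with $K\subseteq J\cap H$ (viewed as spans $X(J)\hookleftarrow X(K)\hookrightarrow X(H)$ over $X$); the composite of $a_K\in\operatorname{Mor}(a_J,a_H)$ and $a_M\in\operatorname{Mor}(a_H,a_L)$ is $a_{K\cap M}$. Root configuration quiver. $\Gamma_X$ is the labelled quiver without multiple arrows whose vertex set is labelled by $I$, with an arrow from $i$ to $j$ if and only if $(i-j)\cdot\langle r(i),r(j)\rangle>0$. $\mathcal L_X$: objects are labelled subquivers of $\Gamma_X$; for two subquivers $Q,Q'$ of $\Gamma_X$, morphisms from $Q$ to $Q'$ are the label-preserving partial isomorphisms of quivers, i.e. diagrams $Q\hookleftarrow P\hookrightarrow Q'$ given by an $I$-labelled quiver $P$ which is a subquiver of both $Q$ and $Q'$; the composite of $Q\hookleftarrow P\hookrightarrow Q'$ and $Q'\hookleftarrow P'\hookrightarrow Q''$ is given by the intersection of $P$ and $P'$ in $Q'$.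
   Formalization: "Subquiver" (objects of L_X and the quivers P giving morphisms) is taken to mean full subquiver; if arrows may be omitted the claim fails, e.g. for type A2, Q = s1 s2, π = e, where the quiver has 5 subquivers but the span category only 4 objects. *)

theory Defs
  imports Complex_Main "HOL-Library.FuncSet" "HOL-Algebra.Generated_Groups" "HOL-Algebra.Multiplicative_Group"
begin

section \<open>Categories\<close>

text \<open>
  Hom-sets are indexed by source and target and need not be disjoint; accordingly composition takes
  the three objects involved.  \<open>Comp C a b c f g\<close> is the composite of \<open>f : a \<rightarrow> b\<close> followed by
  \<open>g : b \<rightarrow> c\<close>.
\<close>

record ('o, 'm) cat =
  Ob :: "'o set"
  Hom :: "'o \<Rightarrow> 'o \<Rightarrow> 'm set"
  Idn :: "'o \<Rightarrow> 'm"
  Comp :: "'o \<Rightarrow> 'o \<Rightarrow> 'o \<Rightarrow> 'm \<Rightarrow> 'm \<Rightarrow> 'm"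

definition is_category :: "('o, 'm) cat \<Rightarrow> bool" where
  "is_category C \<longleftrightarrow>
     (\<forall>a\<in>Ob C. Idn C a \<in> Hom C a a) \<and>
     (\<forall>a\<in>Ob C. \<forall>b\<in>Ob C. \<forall>c\<in>Ob C. \<forall>f\<in>Hom C a b. \<forall>g\<in>Hom C b c.
        Comp C a b c f g \<in> Hom C a c) \<and>
     (\<forall>a\<in>Ob C. \<forall>b\<in>Ob C. \<forall>f\<in>Hom C a b.
        Comp C a a b (Idn C a) f = f \<and> Comp C a b b f (Idn C b) = f) \<and>
     (\<forall>a\<in>Ob C. \<forall>b\<in>Ob C. \<forall>c\<in>Ob C. \<forall>d\<in>Ob C.
        \<forall>f\<in>Hom C a b. \<forall>g\<in>Hom C b c. \<forall>h\<in>Hom C c d.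
          Comp C a c d (Comp C a b c f g) h = Comp C a b d f (Comp C b c d g h))"

definition is_functor ::
    "('o, 'm) cat \<Rightarrow> ('p, 'n) cat \<Rightarrow> ('o \<Rightarrow> 'p) \<Rightarrow> ('o \<Rightarrow> 'o \<Rightarrow> 'm \<Rightarrow> 'n) \<Rightarrow> bool" where
  "is_functor C D Fo Fm \<longleftrightarrow>
     is_category C \<and> is_category D \<and>
     (\<forall>a\<in>Ob C. Fo a \<in> Ob D) \<and>
     (\<forall>a\<in>Ob C. \<forall>b\<in>Ob C. \<forall>f\<in>Hom C a b. Fm a b f \<in> Hom D (Fo a) (Fo b)) \<and>
     (\<forall>a\<in>Ob C. Fm a a (Idn C a) = Idn D (Fo a)) \<and>
     (\<forall>a\<in>Ob C. \<forall>b\<in>Ob C. \<forall>c\<in>Ob C. \<forall>f\<in>Hom C a b. \<forall>g\<in>Hom C b c.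
        Fm a c (Comp C a b c f g) = Comp D (Fo a) (Fo b) (Fo c) (Fm a b f) (Fm b c g))"

definition isomorphic_categories :: "('o, 'm) cat \<Rightarrow> ('p, 'n) cat \<Rightarrow> bool" where
  "isomorphic_categories C D \<longleftrightarrow>
     (\<exists>Fo Fm. is_functor C D Fo Fm \<and> bij_betw Fo (Ob C) (Ob D) \<and>
        (\<forall>a\<in>Ob C. \<forall>b\<in>Ob C. bij_betw (Fm a b) (Hom C a b) (Hom D (Fo a) (Fo b))))"


section \<open>Coxeter systems\<close>

definition eval_word :: "('g, 'x) monoid_scheme \<Rightarrow> 'g list \<Rightarrow> 'g" where
  "eval_word G w = foldr (\<lambda>s g. s \<otimes>\<^bsub>G\<^esub> g) w \<one>\<^bsub>G\<^esub>"

text \<open>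
  The congruence on words in \<open>S\<close> generated by the Coxeter relations \<open>(s t)\<^sup>k = 1\<close>, where \<open>k\<close> is the
  order of \<open>s t\<close>, if finite.  Isabelle's \<open>group.ord\<close> is \<open>0\<close> for elements of infinite order.
\<close>

inductive cox_equiv :: "('g, 'x) monoid_scheme \<Rightarrow> 'g set \<Rightarrow> 'g list \<Rightarrow> 'g list \<Rightarrow> bool"
  for G :: "('g, 'x) monoid_scheme" and S :: "'g set" where
  cox_refl: "w \<in> lists S \<Longrightarrow> cox_equiv G S w w"
| cox_sym: "cox_equiv G S v w \<Longrightarrow> cox_equiv G S w v"
| cox_trans: "cox_equiv G S u v \<Longrightarrow> cox_equiv G S v w \<Longrightarrow> cox_equiv G S u w"
| cox_rel: "u \<in> lists S \<Longrightarrow> v \<in> lists S \<Longrightarrow> s \<in> S \<Longrightarrow> t \<in> S \<Longrightarrow>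
    k = group.ord G (s \<otimes>\<^bsub>G\<^esub> t) \<Longrightarrow> 0 < k \<Longrightarrow>
    cox_equiv G S (u @ concat (replicate k [s, t]) @ v) (u @ v)"

text \<open>
  \<open>G\<close> is presented by the generators \<open>S\<close> and the relations above.  Since the generators are
  involutions, the presentation of the group coincides with that of the monoid, so that it suffices
  to consider words in \<open>S\<close>.
\<close>

definition coxeter_system :: "('g, 'x) monoid_scheme \<Rightarrow> 'g set \<Rightarrow> bool" where
  "coxeter_system G S \<longleftrightarrow>
     group G \<and> S \<subseteq> carrier G \<and> generate G S = carrier G \<and>
     (\<forall>s\<in>S. group.ord G s = 2) \<and>
     (\<forall>w\<in>lists S. eval_word G w = \<one>\<^bsub>G\<^esub> \<longrightarrow> cox_equiv G S w [])"

definition reduced_expression ::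
    "('g, 'x) monoid_scheme \<Rightarrow> 'g set \<Rightarrow> 'g list \<Rightarrow> 'g \<Rightarrow> bool" where
  "reduced_expression G S w g \<longleftrightarrow>
     w \<in> lists S \<and> eval_word G w = g \<and>
     (\<forall>u\<in>lists S. eval_word G u = g \<longrightarrow> length w \<le> length u)"


section \<open>Quadruples\<close>

text \<open>
  The letters of the word are labelled by the finite set \<open>pos\<close> of positions (read in increasing
  order), so that the quadruple of a flat can be labelled by the positions in that flat.
  \<open>sroot s\<close> is the simple root of the simple reflection \<open>s\<close>, as a vector in the ambient type.
\<close>

record ('g, 'v) quadruple =
  grp :: "'g monoid"
  simples :: "'g set"
  sroot :: "'g \<Rightarrow> 'v"
  pos :: "nat set"
  word :: "nat \<Rightarrow> 'g"
  elt :: "'g"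
  face :: "nat set"

abbreviation ev :: "('g, 'v::real_vector) quadruple \<Rightarrow> 'g list \<Rightarrow> 'g" where
  "ev X \<equiv> eval_word (grp X)"

definition subword :: "('g, 'v::real_vector) quadruple \<Rightarrow> nat set \<Rightarrow> 'g list" where
  "subword X A = map (word X) (sorted_list_of_set A)"

definition V :: "('g, 'v::real_vector) quadruple \<Rightarrow> 'v set" where
  "V X = span (sroot X ` simples X)"

definition coord :: "('g, 'v::real_vector) quadruple \<Rightarrow> 'v \<Rightarrow> 'g \<Rightarrow> real" where
  "coord X v s = representation (sroot X ` simples X) v (sroot X s)"

text \<open>For \<open>s t\<close> of infinite order the coefficient is \<open>- cos (pi / 0) = - cos 0 = - 1\<close>.\<close>

definition form :: "('g, 'v::real_vector) quadruple \<Rightarrow> 'v \<Rightarrow> 'v \<Rightarrow> real" where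
  "form X u v = (\<Sum>s\<in>simples X. \<Sum>t\<in>simples X.
     coord X u s * coord X v t *
     (- cos (pi / real (group.ord (grp X) (s \<otimes>\<^bsub>grp X\<^esub> t)))))"

text \<open>The reflection in a vector \<open>b\<close> of square length \<open>1\<close>, such as a root.\<close>

definition reflect :: "('g, 'v::real_vector) quadruple \<Rightarrow> 'v \<Rightarrow> 'v \<Rightarrow> 'v" where
  "reflect X b v = v - (2 * form X v b) *\<^sub>R b"

text \<open>The geometric action of the group element represented by a word.\<close>

definition act :: "('g, 'v::real_vector) quadruple \<Rightarrow> 'g list \<Rightarrow> 'v \<Rightarrow> 'v" where
  "act X w v = foldr (\<lambda>s. reflect X (sroot X s)) w v"

definition complex_face :: "('g, 'v::real_vector) quadruple \<Rightarrow> nat set \<Rightarrow> bool" where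
  "complex_face X A \<longleftrightarrow>
     A \<subseteq> pos X \<and>
     (\<exists>B \<subseteq> pos X - A. reduced_expression (grp X) (simples X) (subword X B) (elt X))"

definition is_quadruple :: "('g, 'v::real_vector) quadruple \<Rightarrow> bool" where
  "is_quadruple X \<longleftrightarrow>
     coxeter_system (grp X) (simples X) \<and> finite (simples X) \<and>
     inj_on (sroot X) (simples X) \<and> independent (sroot X ` simples X) \<and>
     (\<exists>m. pos X = {1..m}) \<and> word X ` pos X \<subseteq> simples X \<and> elt X \<in> carrier (grp X) \<and>
     complex_face X (face X) \<and> (\<forall>A. complex_face X A \<and> face X \<subseteq> A \<longrightarrow> A = face X)"

definition prefix_word :: "('g, 'v::real_vector) quadruple \<Rightarrow> nat \<Rightarrow> 'g list" where
  "prefix_word X l = subword X {j \<in> pos X - face X. j < l}"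

definition root_fn :: "('g, 'v::real_vector) quadruple \<Rightarrow> nat \<Rightarrow> 'v" where
  "root_fn X l = act X (prefix_word X l) (sroot X (word X l))"

definition irreducible_quadruple :: "('g, 'v::real_vector) quadruple \<Rightarrow> bool" where
  "irreducible_quadruple X \<longleftrightarrow> span (root_fn X ` face X) = V X"

definition root_independent :: "('g, 'v::real_vector) quadruple \<Rightarrow> bool" where
  "root_independent X \<longleftrightarrow>
     inj_on (root_fn X) (face X) \<and> independent (root_fn X ` face X) \<and>
     span (root_fn X ` face X) = V X"


section \<open>Flats and the quadruples they determine\<close>

definition flat :: "('g, 'v::real_vector) quadruple \<Rightarrow> 'v set \<Rightarrow> nat set" where
  "flat X U = {i \<in> pos X. root_fn X i \<in> U}"

definition flat_of :: "('g, 'v::real_vector) quadruple \<Rightarrow> nat set \<Rightarrow> nat set" where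
  "flat_of X J = flat X (span (root_fn X ` J))"

text \<open>All pairs of a root \<open>w(\<alpha>\<^sub>s)\<close> and the group element \<open>w s w\<^sup>-\<^sup>1\<close> acting as the reflection in it.\<close>

definition root_reflections :: "('g, 'v::real_vector) quadruple \<Rightarrow> ('v \<times> 'g) set" where
  "root_reflections X =
     {(act X w (sroot X s), ev X w \<otimes>\<^bsub>grp X\<^esub> s \<otimes>\<^bsub>grp X\<^esub> inv\<^bsub>grp X\<^esub> (ev X w)) | w s.
        w \<in> lists (simples X) \<and> s \<in> simples X}"

definition roots :: "('g, 'v::real_vector) quadruple \<Rightarrow> 'v set" where
  "roots X = fst ` root_reflections X"

definition pos_roots :: "('g, 'v::real_vector) quadruple \<Rightarrow> 'v set" where
  "pos_roots X = {b \<in> roots X. \<forall>s\<in>simples X. 0 \<le> coord X b s}"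

text \<open>
  The simple roots of \<open>\<Phi> \<inter> U\<close> with respect to the positive roots in \<open>U\<close>, i.e. the canonical
  generators of a reflection subgroup in the sense of Deodhar and Dyer: those positive roots in
  \<open>U\<close> whose reflection keeps all other positive roots in \<open>U\<close> positive.
\<close>

definition simple_roots_in :: "('g, 'v::real_vector) quadruple \<Rightarrow> 'v set \<Rightarrow> 'v set" where
  "simple_roots_in X U =
     {b \<in> pos_roots X \<inter> U. \<forall>c \<in> (pos_roots X \<inter> U) - {b}. reflect X b c \<in> pos_roots X}"

definition subgroup_in :: "('g, 'v::real_vector) quadruple \<Rightarrow> 'v set \<Rightarrow> 'g monoid" where
  "subgroup_in X U =
     (grp X)\<lparr>carrier := generate (grp X) {t. \<exists>b\<in>U. (b, t) \<in> root_reflections X}\<rparr>"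

definition simples_in :: "('g, 'v::real_vector) quadruple \<Rightarrow> 'v set \<Rightarrow> 'g set" where
  "simples_in X U = {t. \<exists>b\<in>simple_roots_in X U. (b, t) \<in> root_reflections X}"

definition sroot_in :: "('g, 'v::real_vector) quadruple \<Rightarrow> 'v set \<Rightarrow> 'g \<Rightarrow> 'v" where
  "sroot_in X U = (\<lambda>t\<in>simples_in X U. THE b. b \<in> simple_roots_in X U \<and> (b, t) \<in> root_reflections X)"

text \<open>The element of \<open>W\<close> that acts as the reflection in the root \<open>root_fn X l\<close>.\<close>

definition refl_at :: "('g, 'v::real_vector) quadruple \<Rightarrow> nat \<Rightarrow> 'g" where
  "refl_at X l =
     ev X (prefix_word X l) \<otimes>\<^bsub>grp X\<^esub> word X l \<otimes>\<^bsub>grp X\<^esub> inv\<^bsub>grp X\<^esub> (ev X (prefix_word X l))"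

text \<open>
  The letters \<open>s'\<^sub>l\<close> (\<open>l \<in> F\<close>) of the word of the quadruple of a flat \<open>F\<close> are forced by the requirement
  that the root function values be those of \<open>X\<close>.  Write \<open>t\<^sub>l\<close> for the reflection in the root at
  position \<open>l\<close>, and \<open>w'\<^sub>l\<close> for the product of the letters \<open>s'\<^sub>j\<close> over \<open>j \<in> F - I\<close> with \<open>j < l\<close>.  Then
  \<open>s'\<^sub>l\<close> must be the simple reflection whose simple root \<open>w'\<^sub>l\<close> maps to the root at \<open>l\<close>, that is
  \<open>s'\<^sub>l = w'\<^sub>l\<^sup>-\<^sup>1 t\<^sub>l w'\<^sub>l\<close>.  Hence appending \<open>s'\<^sub>l\<close> to \<open>w'\<^sub>l\<close> gives \<open>t\<^sub>l w'\<^sub>l\<close>, and so \<open>w'\<^sub>l\<close> is the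
  product of the reflections \<open>t\<^sub>j\<close> over \<open>j \<in> F - I\<close>, \<open>j < l\<close>, in decreasing order of \<open>j\<close>.
\<close>

definition flat_prefix :: "('g, 'v::real_vector) quadruple \<Rightarrow> nat set \<Rightarrow> nat \<Rightarrow> 'g" where
  "flat_prefix X F l =
     ev X (map (refl_at X) (rev (sorted_list_of_set {j \<in> F - face X. j < l})))"

definition flat_word :: "('g, 'v::real_vector) quadruple \<Rightarrow> nat set \<Rightarrow> nat \<Rightarrow> 'g" where
  "flat_word X F = (\<lambda>l\<in>F.
     inv\<^bsub>grp X\<^esub> (flat_prefix X F l) \<otimes>\<^bsub>grp X\<^esub> refl_at X l \<otimes>\<^bsub>grp X\<^esub> flat_prefix X F l)"

definition flat_quadruple ::
    "('g, 'v::real_vector) quadruple \<Rightarrow> nat set \<Rightarrow> ('g, 'v) quadruple" where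
  "flat_quadruple X F =
     (let U = span (root_fn X ` F) in
      \<lparr>grp = subgroup_in X U,
       simples = simples_in X U,
       sroot = sroot_in X U,
       pos = F,
       word = flat_word X F,
       elt = ev X (map (flat_word X F) (sorted_list_of_set (F - face X))),
       face = F \<inter> face X\<rparr>)"

definition sub_quadruple ::
    "('g, 'v::real_vector) quadruple \<Rightarrow> nat set \<Rightarrow> ('g, 'v) quadruple" where
  "sub_quadruple X J = flat_quadruple X (flat_of X J)"


section \<open>The category of spans over X\<close>

text \<open>
  A diagram from a source to a target quadruple consists of a map of positions and a map of the
  vector spaces spanned by the root systems.
\<close>

record ('g, 'v) diagram =
  src :: "('g, 'v) quadruple"
  tgt :: "('g, 'v) quadruple"
  pos_map :: "nat \<Rightarrow> nat"
  vec_map :: "'v \<Rightarrow> 'v"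

text \<open>The diagram \<open>a\<^sub>J : X(J) \<rightarrow> X\<close>; both components of the canonical embedding are inclusions.\<close>

definition emb :: "('g, 'v::real_vector) quadruple \<Rightarrow> nat set \<Rightarrow> ('g, 'v) diagram" where
  "emb X J =
     \<lparr>src = sub_quadruple X J,
      tgt = X,
      pos_map = (\<lambda>i\<in>flat_of X J. i),
      vec_map = (\<lambda>v\<in>span (root_fn X ` J). v)\<rparr>"

definition emb_index :: "('g, 'v::real_vector) quadruple \<Rightarrow> ('g, 'v) diagram \<Rightarrow> nat set" where
  "emb_index X a = (THE J. J \<subseteq> face X \<and> a = emb X J)"

text \<open>
  A span \<open>X(J) \<leftarrow> X(K) \<rightarrow> X(H)\<close> over \<open>X\<close> is given by the diagram \<open>a\<^sub>K\<close>; the identity of \<open>a\<^sub>J\<close> is the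
  span given by \<open>a\<^sub>J\<close> itself.
\<close>

definition span_cat ::
    "('g, 'v::real_vector) quadruple \<Rightarrow> (('g, 'v) diagram, ('g, 'v) diagram) cat" where
  "span_cat X =
     \<lparr>Ob = {emb X J | J. J \<subseteq> face X},
      Hom = (\<lambda>a b. {emb X K | K J H. J \<subseteq> face X \<and> H \<subseteq> face X \<and>
                       a = emb X J \<and> b = emb X H \<and> K \<subseteq> J \<inter> H}),
      Idn = (\<lambda>a. a),
      Comp = (\<lambda>a b c f g. emb X (emb_index X f \<inter> emb_index X g))\<rparr>"


section \<open>The root configuration quiver and its category of partial isomorphisms\<close>

record quiver =
  verts :: "nat set"
  arrows :: "(nat \<times> nat) set"

definition root_quiver :: "('g, 'v::real_vector) quadruple \<Rightarrow> quiver" where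
  "root_quiver X =
     \<lparr>verts = face X,
      arrows = {(i, j). i \<in> face X \<and> j \<in> face X \<and>
                  (real i - real j) * form X (root_fn X i) (root_fn X j) > 0}\<rparr>"

text \<open>
  Subquivers are full: a labelled subquiver consists of a set of vertices together with all
  arrows between them.  (If arrows could be omitted, then already the objects of \<open>quiver_cat X\<close>
  would be more numerous than the subsets of \<open>face X\<close> whenever the quiver has an arrow.)
\<close>

definition subquiver :: "quiver \<Rightarrow> quiver \<Rightarrow> bool" where
  "subquiver P Q \<longleftrightarrow> verts P \<subseteq> verts Q \<and> arrows P = arrows Q \<inter> (verts P \<times> verts P)"

definition quiver_inter :: "quiver \<Rightarrow> quiver \<Rightarrow> quiver" where
  "quiver_inter P Q = \<lparr>verts = verts P \<inter> verts Q, arrows = arrows P \<inter> arrows Q\<rparr>"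

text \<open>
  Since morphisms preserve labels, a diagram \<open>Q \<leftarrow> P \<rightarrow> Q'\<close> is given by the common subquiver \<open>P\<close>.
\<close>

definition quiver_cat :: "('g, 'v::real_vector) quadruple \<Rightarrow> (quiver, quiver) cat" where
  "quiver_cat X =
     \<lparr>Ob = {Q. subquiver Q (root_quiver X)},
      Hom = (\<lambda>Q Q'. {P. subquiver P Q \<and> subquiver P Q'}),
      Idn = (\<lambda>Q. Q),
      Comp = (\<lambda>Q Q' Q'' P P'. quiver_inter P P')\<rparr>"

end

theory Submission
  imports Defs
begin

text \<open>
  Both categories are copies of one combinatorial category attached to the set
  \<open>I = face X\<close>: its objects are the subsets of \<open>I\<close>, a morphism \<open>J \<rightarrow> H\<close> is a subset of
  \<open>J \<inter> H\<close>, and composition is intersection.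

  For the spans over \<open>X\<close>, the point is that distinct subsets \<open>J\<close> of \<open>I\<close> give distinct diagrams
  \<open>a\<^sub>J\<close>. This is where root independence enters: no root at a position in \<open>I - J\<close> lies in the span
  of the roots at positions in \<open>J\<close>, so the flat \<open>f(J)\<close> meets \<open>I\<close> exactly in \<open>J\<close>, and \<open>J\<close> is
  recovered as the face of the source of \<open>a\<^sub>J\<close> (\<open>flat_of_Int_face\<close>, \<open>inj_on_emb\<close>).

  For the quivers, a full subquiver is determined by its vertices, inclusion of full subquivers is
  inclusion of their vertex sets, and the intersection of two of them is again full.

  Sending \<open>a\<^sub>J\<close> to the full subquiver on \<open>J\<close> is the isomorphism.
\<close>

section \<open>The category of partial identities of a set\<close>

text \<open>
  Subsets of \<open>J \<inter> H\<close> are the partial identity maps from \<open>J\<close> to \<open>H\<close>, whose composition is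
  intersection. The category \<open>C\<close> is compared with this one through a coding \<open>e\<close> of subsets of \<open>A\<close>
  that serves for objects and morphisms alike.
\<close>

definition codes_partial_identities :: "'i set \<Rightarrow> ('i set \<Rightarrow> 'o) \<Rightarrow> ('o, 'o) cat \<Rightarrow> bool" where
  "codes_partial_identities A e C \<longleftrightarrow>
     inj_on e (Pow A) \<and> Ob C = e ` Pow A \<and>
     (\<forall>J\<subseteq>A. \<forall>H\<subseteq>A. Hom C (e J) (e H) = e ` Pow (J \<inter> H)) \<and>
     (\<forall>J\<subseteq>A. Idn C (e J) = e J) \<and>
     (\<forall>J\<subseteq>A. \<forall>H\<subseteq>A. \<forall>L\<subseteq>A. \<forall>K\<subseteq>J \<inter> H. \<forall>M\<subseteq>H \<inter> L.
        Comp C (e J) (e H) (e L) (e K) (e M) = e (K \<inter> M))"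

lemma
  assumes "codes_partial_identities A e C"
  shows codes_inj: "inj_on e (Pow A)"
    and codes_Ob: "Ob C = e ` Pow A"
    and codes_Hom: "J \<subseteq> A \<Longrightarrow> H \<subseteq> A \<Longrightarrow> Hom C (e J) (e H) = e ` Pow (J \<inter> H)"
    and codes_Idn: "J \<subseteq> A \<Longrightarrow> Idn C (e J) = e J"
    and codes_Comp: "J \<subseteq> A \<Longrightarrow> H \<subseteq> A \<Longrightarrow> L \<subseteq> A \<Longrightarrow> K \<subseteq> J \<inter> H \<Longrightarrow> M \<subseteq> H \<inter> L \<Longrightarrow>
      Comp C (e J) (e H) (e L) (e K) (e M) = e (K \<inter> M)"
  using assms unfolding codes_partial_identities_def by simp_all

lemma codes_is_category:
  assumes C: "codes_partial_identities A e C"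
  shows "is_category C"
proof -
  note facts = codes_Ob[OF C] codes_Hom[OF C] codes_Idn[OF C] codes_Comp[OF C]
  have "Idn C a \<in> Hom C a a" if "a \<in> Ob C" for a
    using that by (auto simp: facts)
  moreover have "Comp C a b c f g \<in> Hom C a c"
    if ob: "a \<in> Ob C" "b \<in> Ob C" "c \<in> Ob C" and f: "f \<in> Hom C a b" and g: "g \<in> Hom C b c"
    for a b c f g
  proof -
    obtain J H L where JHL: "J \<subseteq> A" "H \<subseteq> A" "L \<subseteq> A" "a = e J" "b = e H" "c = e L"
      using ob by (auto simp: facts)
    obtain K M where "K \<subseteq> J \<inter> H" "M \<subseteq> H \<inter> L" "f = e K" "g = e M"
      using f g JHL by (auto simp: facts)
    moreover from this have "K \<inter> M \<in> Pow (J \<inter> L)" by blast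
    ultimately show ?thesis
      using JHL by (simp add: facts del: Pow_iff)
  qed
  moreover have "Comp C a a b (Idn C a) f = f \<and> Comp C a b b f (Idn C b) = f"
    if ob: "a \<in> Ob C" "b \<in> Ob C" and f: "f \<in> Hom C a b" for a b f
  proof -
    obtain J H where JH: "J \<subseteq> A" "H \<subseteq> A" "a = e J" "b = e H"
      using ob by (auto simp: facts)
    obtain K where K: "K \<subseteq> J \<inter> H" "f = e K"
      using f JH by (auto simp: facts)
    then have "J \<inter> K = K" "K \<inter> H = K" by auto
    then show ?thesis
      using JH K by (simp add: facts)
  qed
  moreover have "Comp C a c d (Comp C a b c f g) h = Comp C a b d f (Comp C b c d g h)"
    if ob: "a \<in> Ob C" "b \<in> Ob C" "c \<in> Ob C" "d \<in> Ob C"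
      and fgh: "f \<in> Hom C a b" "g \<in> Hom C b c" "h \<in> Hom C c d" for a b c d f g h
  proof -
    obtain J H L N where J: "J \<subseteq> A" "H \<subseteq> A" "L \<subseteq> A" "N \<subseteq> A" "a = e J" "b = e H" "c = e L" "d = e N"
      using ob by (auto simp: facts)
    obtain K M P where K: "K \<subseteq> J \<inter> H" "M \<subseteq> H \<inter> L" "P \<subseteq> L \<inter> N" "f = e K" "g = e M" "h = e P"
      using fgh J by (auto simp: facts)
    have "K \<inter> M \<subseteq> J \<inter> L" "M \<inter> P \<subseteq> H \<inter> N" using K by auto
    then show ?thesis
      using J K by (simp only: facts Int_assoc)
  qed
  ultimately show ?thesis
    unfolding is_category_def by blast
qed

lemma codes_isomorphic:
  assumes C: "codes_partial_identities A e C" and D: "codes_partial_identities A d D"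
  shows "isomorphic_categories C D"
proof -
  note facts = codes_Ob[OF C] codes_Hom[OF C] codes_Idn[OF C] codes_Comp[OF C]
    codes_Ob[OF D] codes_Hom[OF D] codes_Idn[OF D] codes_Comp[OF D]
  define F where "F = d \<circ> the_inv_into (Pow A) e"
  have F: "F (e J) = d J" if "J \<subseteq> A" for J
    using that codes_inj[OF C] by (simp add: F_def the_inv_into_f_f)
  have F_image: "F ` e ` S = d ` S" if "S \<subseteq> Pow A" for S
    unfolding image_image using that F by (intro image_cong) auto
  have inj_F: "inj_on F (e ` Pow A)"
    using codes_inj[OF D] by (auto simp: inj_on_def F)
  have bij: "bij_betw F (e ` S) (d ` S)" if "S \<subseteq> Pow A" for S
    using inj_on_subset[OF inj_F image_mono[OF that]] F_image[OF that]
    by (simp add: bij_betw_def)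
  have F_Comp: "F (Comp C a b c f g) = Comp D (F a) (F b) (F c) (F f) (F g)"
    if ob: "a \<in> Ob C" "b \<in> Ob C" "c \<in> Ob C" and f: "f \<in> Hom C a b" and g: "g \<in> Hom C b c"
    for a b c f g
  proof -
    obtain J H L where JHL: "J \<subseteq> A" "H \<subseteq> A" "L \<subseteq> A" "a = e J" "b = e H" "c = e L"
      using ob by (auto simp: facts)
    obtain K M where KM: "K \<subseteq> J \<inter> H" "M \<subseteq> H \<inter> L" "f = e K" "g = e M"
      using f g JHL by (auto simp: facts)
    have "K \<subseteq> A" "M \<subseteq> A" "K \<inter> M \<subseteq> A" using JHL KM by auto
    then show ?thesis
      using JHL KM by (simp add: facts F)
  qed
  have hom_bij: "bij_betw F (Hom C a b) (Hom D (F a) (F b))"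
    if ob: "a \<in> Ob C" "b \<in> Ob C" for a b
  proof -
    obtain J H where JH: "J \<subseteq> A" "H \<subseteq> A" "a = e J" "b = e H"
      using ob by (auto simp: facts)
    then have "Pow (J \<inter> H) \<subseteq> Pow A" by auto
    from bij[OF this] show ?thesis
      using JH by (simp add: facts F)
  qed
  have F_Hom: "F f \<in> Hom D (F a) (F b)" if "a \<in> Ob C" "b \<in> Ob C" "f \<in> Hom C a b" for a b f
    using bij_betwE[OF hom_bij[OF that(1,2)]] that(3) by blast
  have F_Ob: "F a \<in> Ob D" and F_Idn: "F (Idn C a) = Idn D (F a)" if "a \<in> Ob C" for a
    using that by (auto simp: facts F)
  have "bij_betw F (Ob C) (Ob D)"
    using bij by (simp add: facts)
  moreover have "is_functor C D F (\<lambda>a b. F)"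
    unfolding is_functor_def
    by (intro conjI ballI codes_is_category[OF C] codes_is_category[OF D] F_Ob F_Hom F_Idn F_Comp)
  ultimately show ?thesis
    unfolding isomorphic_categories_def
    using hom_bij by (intro exI[of _ F] exI[of _ "\<lambda>a b. F"]) simp
qed


section \<open>Spans over a root independent quadruple\<close>

lemma face_subset_pos: "is_quadruple X \<Longrightarrow> face X \<subseteq> pos X"
  by (simp add: is_quadruple_def complex_face_def)

text \<open>
  A root at a position of the face outside \<open>J\<close> would, if it lay in the span of the roots at \<open>J\<close>,
  depend linearly on other members of the basis given by the face.
\<close>

lemma flat_of_Int_face:
  assumes X: "is_quadruple X" and indep: "root_independent X" and J: "J \<subseteq> face X"
  shows "flat_of X J \<inter> face X = J"
proof
  show "J \<subseteq> flat_of X J \<inter> face X"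
    using face_subset_pos[OF X] J by (auto simp: flat_of_def flat_def span_base)
next
  show "flat_of X J \<inter> face X \<subseteq> J"
  proof
    fix i assume i: "i \<in> flat_of X J \<inter> face X"
    show "i \<in> J"
    proof (rule ccontr)
      assume "i \<notin> J"
      with i J indep have "root_fn X ` J \<subseteq> root_fn X ` face X - {root_fn X i}"
        by (auto simp: root_independent_def inj_on_def)
      moreover have "root_fn X i \<in> span (root_fn X ` J)"
        using i by (simp add: flat_of_def flat_def)
      ultimately have "dependent (root_fn X ` face X)"
        using i span_mono unfolding dependent_def by blast
      with indep show False
        by (simp add: root_independent_def)
    qed
  qed
qed

lemma inj_on_emb:
  assumes "is_quadruple X" and "root_independent X"
  shows "inj_on (emb X) (Pow (face X))"
proof (rule inj_on_inverseI[where g = "\<lambda>a. face (src a)"])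
  fix J assume "J \<in> Pow (face X)"
  then show "face (src (emb X J)) = J"
    using flat_of_Int_face[OF assms]
    by (simp add: emb_def sub_quadruple_def flat_quadruple_def Let_def)
qed

lemma emb_index_emb:
  assumes "is_quadruple X" and "root_independent X" and "J \<subseteq> face X"
  shows "emb_index X (emb X J) = J"
  unfolding emb_index_def
  using assms(3) inj_onD[OF inj_on_emb[OF assms(1,2)]] by (intro the_equality) auto

lemma codes_span_cat:
  assumes X: "is_quadruple X" and indep: "root_independent X"
  shows "codes_partial_identities (face X) (emb X) (span_cat X)"
proof -
  note inj = inj_on_emb[OF X indep]
  have emb_eq: "emb X J = emb X J' \<longleftrightarrow> J = J'" if "J \<subseteq> face X" "J' \<subseteq> face X" for J J'
    using inj_on_eq_iff[OF inj] that by simp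
  have "Hom (span_cat X) (emb X J) (emb X H) = emb X ` Pow (J \<inter> H)"
    if "J \<subseteq> face X" "H \<subseteq> face X" for J H
    using that by (auto simp: span_cat_def emb_eq)
  moreover have "Comp (span_cat X) a b c (emb X K) (emb X M) = emb X (K \<inter> M)"
    if "K \<subseteq> face X" "M \<subseteq> face X" for a b c K M
    using that by (simp add: span_cat_def emb_index_emb[OF X indep])
  ultimately show ?thesis
    using inj unfolding codes_partial_identities_def by (auto simp: span_cat_def)
qed


section \<open>Full subquivers\<close>

definition full_subquiver :: "quiver \<Rightarrow> nat set \<Rightarrow> quiver" where
  "full_subquiver R J = \<lparr>verts = J, arrows = arrows R \<inter> (J \<times> J)\<rparr>"

lemma subquiver_iff_full:
  "subquiver Q R \<longleftrightarrow> (\<exists>J \<subseteq> verts R. Q = full_subquiver R J)"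
  by (cases Q) (auto simp: subquiver_def full_subquiver_def)

lemma full_subquiver_of_full:
  "J \<subseteq> H \<Longrightarrow> full_subquiver (full_subquiver R H) J = full_subquiver R J"
  by (auto simp: full_subquiver_def)

lemma subquiver_full_iff:
  "subquiver P (full_subquiver R H) \<longleftrightarrow> (\<exists>K \<subseteq> H. P = full_subquiver R K)"
proof -
  have "verts (full_subquiver R H) = H"
    by (simp add: full_subquiver_def)
  then show ?thesis
    by (auto simp: subquiver_iff_full full_subquiver_of_full)
qed

lemma quiver_inter_full:
  "quiver_inter (full_subquiver R K) (full_subquiver R M) = full_subquiver R (K \<inter> M)"
  by (auto simp: quiver_inter_def full_subquiver_def)

lemma full_subquiver_eq_iff: "full_subquiver R J = full_subquiver R H \<longleftrightarrow> J = H"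
  by (auto simp: full_subquiver_def)

lemma codes_quiver_cat:
  "codes_partial_identities (face X) (full_subquiver (root_quiver X)) (quiver_cat X)"
proof -
  let ?e = "full_subquiver (root_quiver X)"
  have "verts (root_quiver X) = face X"
    by (simp add: root_quiver_def)
  then have "Ob (quiver_cat X) = ?e ` Pow (face X)"
    by (auto simp: quiver_cat_def subquiver_iff_full)
  moreover have "Hom (quiver_cat X) (?e J) (?e H) = ?e ` Pow (J \<inter> H)" for J H
    by (auto simp: quiver_cat_def subquiver_full_iff full_subquiver_eq_iff)
  ultimately show ?thesis
    unfolding codes_partial_identities_def
    by (auto simp: inj_on_def full_subquiver_eq_iff quiver_cat_def quiver_inter_full)
qed


section \<open>The isomorphism\<close>

theorem proposition3p10:
  fixes X :: "('g, 'v::real_vector) quadruple"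
  assumes "is_quadruple X"
    and "irreducible_quadruple X"
    and "root_independent X"
  shows "isomorphic_categories (span_cat X) (quiver_cat X)"
  using codes_span_cat[OF assms(1,3)] codes_quiver_cat by (rule codes_isomorphic)

end
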